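(* Let $\mathbf{B}$ be a countable structure with carrier $B$ such that $\operatorname{End}(\mathbf{B})$ has only finitely many weak orbits on $B$, and let $h$ be a monoid-isomorphism from the monoid of non-expansive selfmaps of the rational Urysohn space $\mathbb{U}_0$ to $\operatorname{End}(\mathbf{B})$. Then $h$ is a homeomorphism.
   Context: A structure means a relational structure: a set $B$ (the carrier) with a family of finitary relations on $B$ indexed by an arbitrary relational signature. $\operatorname{End}(\mathbf{B})$ is the monoid, under composition, of all endomorphisms of $\mathbf{B}$, i.e. of all maps $B\to B$ preserving every basic relation. The rational Urysohn space $\mathbb{U}_0$ is the (up to isometry unique) countable metric space with rational distances that contains an isometric copy of every finite metric space with rational distances and in which every isometry between finite subspaces extends to an isometry of $\mathbb{U}_0$ onto itself. A selfmap $f$ of a metric space $(A,d)$ is non-expansive if $d(f(x),f(y))\le d(x,y)$ for all $x,y\in A$. For a set $B$, let $\mathfrak{T}_B$ be the monoid of all maps $B\to B$. It carries the topology of pointwise convergence (the product topology on $B^B$ with $B$ given the discrete topology), and every submonoid of $\mathfrak{T}_B$ carries the subspace topology. This is the topology used on $\operatorname{End}(\mathbf{B})$ and also on the monoid of non-expansive selfmaps of $\mathbb{U}_0$ (so the carrier of $\mathbb{U}_0$ is treated as a discrete set). Weak orbits: for a transformation monoid $\mathfrak{M}\le\mathfrak{T}_B$ and $a,b\in B$, put $a\preceq b$ if there is $m\in\mathfrak{M}$ with $m(b)=a$. The weak orbits of $\mathfrak{M}$ on $B$ are the classes of the least equivalence relation on $B$ containing $\preceq$. *)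

theory Defs
  imports "HOL-Analysis.Analysis" "HOL-Algebra.Group"
begin

section \<open>Transformation monoids\<close>

text \<open>
  Selfmaps of a carrier set \<open>B\<close> are the extensional functions in \<open>B \<rightarrow>\<^sub>E B\<close>, so that two maps
  agreeing on \<open>B\<close> are equal. A set \<open>T \<subseteq> B \<rightarrow>\<^sub>E B\<close> plays the role of a transformation monoid on \<open>B\<close>
  if it contains the identity and is closed under composition.
\<close>

definition transformation_monoid :: "'b set \<Rightarrow> ('b \<Rightarrow> 'b) set \<Rightarrow> ('b \<Rightarrow> 'b) monoid" where
  "transformation_monoid B T = \<lparr>carrier = T, mult = compose B, one = (\<lambda>x\<in>B. x)\<rparr>"

definition pointwise_topology :: "'b set \<Rightarrow> ('b \<Rightarrow> 'b) set \<Rightarrow> ('b \<Rightarrow> 'b) topology" where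
  "pointwise_topology B T = subtopology (product_topology (\<lambda>_. discrete_topology B) B) T"

definition weak_preorder :: "'b set \<Rightarrow> ('b \<Rightarrow> 'b) set \<Rightarrow> ('b \<times> 'b) set" where
  "weak_preorder B T = {(a, b). a \<in> B \<and> b \<in> B \<and> (\<exists>m\<in>T. m b = a)}"

definition weak_orbits :: "'b set \<Rightarrow> ('b \<Rightarrow> 'b) set \<Rightarrow> 'b set set" where
  "weak_orbits B T = B // \<Inter>{r. equiv B r \<and> weak_preorder B T \<subseteq> r}"


section \<open>Relational structures\<close>

text \<open>
  The signature consists of a set \<open>I\<close> of relation symbols with arities \<open>ar\<close>; an \<open>n\<close>-ary relation is
  a set of lists of length \<open>n\<close>.
\<close>

locale relational_structure =
  fixes B :: "'b set" and I :: "'i set" and ar :: "'i \<Rightarrow> nat" and R :: "'i \<Rightarrow> 'b list set"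
  assumes relation: "\<And>i. i \<in> I \<Longrightarrow> R i \<subseteq> {xs. length xs = ar i \<and> set xs \<subseteq> B}"

definition endomorphisms :: "'b set \<Rightarrow> 'i set \<Rightarrow> ('i \<Rightarrow> 'b list set) \<Rightarrow> ('b \<Rightarrow> 'b) set" where
  "endomorphisms B I R = {f \<in> B \<rightarrow>\<^sub>E B. \<forall>i\<in>I. \<forall>xs\<in>R i. map f xs \<in> R i}"


section \<open>The rational Urysohn space\<close>

definition isometry_onto ::
    "'a set \<Rightarrow> ('a \<Rightarrow> 'a \<Rightarrow> real) \<Rightarrow> 'c set \<Rightarrow> ('c \<Rightarrow> 'c \<Rightarrow> real) \<Rightarrow> ('a \<Rightarrow> 'c) \<Rightarrow> bool" where
  "isometry_onto X d Y e f \<longleftrightarrow> f ` X = Y \<and> (\<forall>x\<in>X. \<forall>y\<in>X. e (f x) (f y) = d x y)"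

text \<open>
  In the universality condition it suffices to let the finite metric spaces have carriers inside
  \<^typ>\<open>nat\<close>, since every finite metric space is isometric to one of these.
\<close>

locale rational_Urysohn_space = Metric_space U d
  for U :: "'a set" and d :: "'a \<Rightarrow> 'a \<Rightarrow> real" +
  assumes countable_carrier: "countable U"
    and rational_distances: "\<And>x y. x \<in> U \<Longrightarrow> y \<in> U \<Longrightarrow> d x y \<in> \<rat>"
    and universal: "\<And>(F :: nat set) e.
      Metric_space F e \<Longrightarrow> finite F \<Longrightarrow> (\<And>x y. x \<in> F \<Longrightarrow> y \<in> F \<Longrightarrow> e x y \<in> \<rat>) \<Longrightarrow>
      \<exists>X f. X \<subseteq> U \<and> isometry_onto F e X d f"
    and homogeneous: "\<And>X Y f.
      finite X \<Longrightarrow> X \<subseteq> U \<Longrightarrow> finite Y \<Longrightarrow> Y \<subseteq> U \<Longrightarrow> isometry_onto X d Y d f \<Longrightarrow>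
      \<exists>g. isometry_onto U d U d g \<and> (\<forall>x\<in>X. g x = f x)"

definition nonexpansive_maps :: "'a set \<Rightarrow> ('a \<Rightarrow> 'a \<Rightarrow> real) \<Rightarrow> ('a \<Rightarrow> 'a) set" where
  "nonexpansive_maps A d = {f \<in> A \<rightarrow>\<^sub>E A. \<forall>x\<in>A. \<forall>y\<in>A. d (f x) (f y) \<le> d x y}"

end

theory Submission
  imports Defs
begin

text \<open>
  A map between transformation monoids is continuous as soon as it is \<^emph>\<open>finitely supported\<close>: each
  value \<open>h f b\<close> is determined by the restriction of \<open>f\<close> to a finite set that depends on \<open>b\<close> only.
  Both \<open>h\<close> and its inverse have this property, for unrelated reasons.

  For the inverse, let \<open>c\<^sub>x\<close> be the constant map with value \<open>x\<close>. It is a left zero, \<open>c\<^sub>x \<circ> f = c\<^sub>x\<close>, so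
  \<open>z = h c\<^sub>x\<close> satisfies \<open>z \<circ> m = z\<close> for all endomorphisms \<open>m\<close>. Hence \<open>z\<close> is constant on weak orbits,
  and its image is finite (\<open>finite_image_of_left_zero\<close>). From \<open>f \<circ> c\<^sub>x = c\<^bsub>f x\<^esub>\<close> one reads off that
  \<open>h f\<close>, restricted to this finite image, determines \<open>h c\<^bsub>f x\<^esub>\<close> and thus \<open>f x\<close>.

  For \<open>h\<close> itself, all that matters is that \<open>f \<mapsto> h f b\<close> takes countably many values and is compatible
  with composition from the left (\<open>finite_support\<close>). Without a finite support there are
  nonexpansive maps \<open>f\<^sub>n\<close>, \<open>g\<^sub>n\<close> that agree on the first \<open>n\<close> points of \<open>U\<close> although
  \<open>h f\<^sub>n b \<noteq> h g\<^sub>n b\<close>. One then builds nonexpansive maps \<open>m\<^sub>S\<close> for \<open>S \<subseteq> \<nat>\<close> and \<open>k\<^sub>n\<close> for \<open>n \<in> \<nat>\<close> such that \<open>k\<^sub>n \<circ> m\<^sub>S\<close> is \<open>f\<^sub>n\<close> or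
  \<open>g\<^sub>n\<close> according to whether \<open>n \<in> S\<close>. So \<open>h m\<^sub>S b\<close> determines \<open>S\<close>, and \<open>f \<mapsto> h f b\<close> takes
  uncountably many values, a contradiction.

  Morally \<open>m\<^sub>S\<close> sends \<open>x\<close> to \<open>x\<close> together with the sequence whose \<open>n\<close>-th entry is \<open>f\<^sub>n x\<close> or \<open>g\<^sub>n x\<close>, and
  \<open>k\<^sub>n\<close> is a projection. Since \<open>f\<^sub>n x = g\<^sub>n x\<close> for almost all \<open>n\<close>, only countably many such sequences
  occur, and the supremum metric on them is rational. It remains to place this countable space in \<open>U\<close>
  in such a way that nonexpansive maps from it to \<open>U\<close> extend to all of \<open>U\<close>. Not every copy
  has this property, but one whose points are added by free amalgamation has
  (\<open>embed_with_extensions\<close>): each point of \<open>U\<close> then sees almost all of the copy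
  only along shortest ways through finitely many of its points.
\<close>

section \<open>One-point extensions of finite subspaces\<close>

context rational_Urysohn_space
begin

text \<open>
  Universality yields a copy of \<open>F\<close> with one extra point at the distances \<open>\<phi>\<close>, and homogeneity
  moves that copy back onto \<open>F\<close>. Positivity of \<open>\<phi>\<close> keeps the extra point apart from \<open>F\<close>.
\<close>

lemma realize_Katetov_function:
  assumes F: "finite F" "F \<subseteq> U"
    and rat: "\<And>a. a \<in> F \<Longrightarrow> \<phi> a \<in> \<rat>" and pos: "\<And>a. a \<in> F \<Longrightarrow> \<phi> a > 0"
    and lip: "\<And>a b. a \<in> F \<Longrightarrow> b \<in> F \<Longrightarrow> \<phi> a \<le> \<phi> b + d a b"
    and wide: "\<And>a b. a \<in> F \<Longrightarrow> b \<in> F \<Longrightarrow> d a b \<le> \<phi> a + \<phi> b"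
  shows "\<exists>z\<in>U. \<forall>a\<in>F. d z a = \<phi> a"
proof -
  \<comment> \<open>The extended space lives on \<^typ>\<open>nat\<close>: the new point is \<open>0\<close>, and \<open>c\<close> codes the points of \<open>F\<close>.
    Off its carrier \<open>e\<close> is \<open>0\<close>, because symmetry and nonnegativity are demanded of all arguments.\<close>
  define c where "c a = Suc (to_nat_on U a)" for a
  define N where "N = insert 0 (c ` F)"
  define pt where "pt i = from_nat_into U (i - 1)" for i
  define e where "e i j = (if i \<notin> N \<or> j \<notin> N then 0
      else if i = 0 then (if j = 0 then 0 else \<phi> (pt j))
      else if j = 0 then \<phi> (pt i) else d (pt i) (pt j))" for i j
  have in_U: "a \<in> U" if "a \<in> F" for a using that F by auto
  have pt_c: "pt (c a) = a" if "a \<in> F" for a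
    using in_U[OF that] countable_carrier by (simp add: pt_def c_def)
  have c_eq: "c a = c b \<longleftrightarrow> a = b" if "a \<in> F" "b \<in> F" for a b
    using pt_c that by metis
  have c_0: "c a \<noteq> 0" "0 \<noteq> c a" for a by (simp_all add: c_def)
  have c_in: "c a \<in> N" if "a \<in> F" for a using that by (simp add: N_def)
  have e_simps: "e 0 0 = 0" "a \<in> F \<Longrightarrow> e 0 (c a) = \<phi> a" "a \<in> F \<Longrightarrow> e (c a) 0 = \<phi> a"
    "a \<in> F \<Longrightarrow> b \<in> F \<Longrightarrow> e (c a) (c b) = d a b" for a b
    by (simp_all add: e_def c_in pt_c) (simp_all add: N_def c_def)
  have cases_N: thesis if "i \<in> N" "i = 0 \<Longrightarrow> thesis" "\<And>a. a \<in> F \<Longrightarrow> i = c a \<Longrightarrow> thesis" for i thesis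
    using that by (auto simp: N_def)
  have pt_F: "pt i \<in> F" if "i \<in> N" "i \<noteq> 0" for i
    using that pt_c by (auto simp: N_def)
  have "Metric_space N e"
  proof
    show "0 \<le> e i j" for i j
      using pt_F pos by (auto simp: e_def less_imp_le)
    show "e i j = e j i" for i j
      by (auto simp: e_def commute)
    show "e i j = 0 \<longleftrightarrow> i = j" if ij: "i \<in> N" "j \<in> N" for i j
    proof (rule cases_N[OF ij(1)]; rule cases_N[OF ij(2)])
      fix a b assume "a \<in> F" "b \<in> F" "i = c a" "j = c b"
      then show ?thesis by (simp add: e_simps c_eq in_U)
    next
      fix a assume "a \<in> F" "i = 0" "j = c a"
      then show ?thesis using pos[of a] by (simp add: e_simps c_0)
    next
      fix a assume "a \<in> F" "i = c a" "j = 0"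
      then show ?thesis using pos[of a] by (simp add: e_simps c_0)
    qed (simp add: e_simps)
    show "e i k \<le> e i j + e j k" if ijk: "i \<in> N" "j \<in> N" "k \<in> N" for i j k
    proof (rule cases_N[OF ijk(1)]; rule cases_N[OF ijk(2)]; rule cases_N[OF ijk(3)])
      fix a b assume ab: "a \<in> F" "b \<in> F" "i = c a" "j = c b" "k = 0"
      then show ?thesis using lip[of a b] by (simp add: e_simps)
    next
      fix a b assume ab: "a \<in> F" "b \<in> F" "i = 0" "j = c a" "k = c b"
      then show ?thesis using lip[of b a] by (simp add: e_simps commute)
    next
      fix a b assume ab: "a \<in> F" "b \<in> F" "i = c a" "j = 0" "k = c b"
      then show ?thesis using wide[of a b] by (simp add: e_simps)
    next
      fix a b c' assume "a \<in> F" "b \<in> F" "c' \<in> F" "i = c a" "j = c b" "k = c c'"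
      then show ?thesis using triangle in_U by (simp add: e_simps)
    qed (simp_all add: e_simps less_imp_le[OF pos])
  qed
  moreover have "finite N" using F by (simp add: N_def)
  moreover have "e i j \<in> \<rat>" for i j
    using pt_F in_U by (auto simp: e_def rat rational_distances)
  ultimately obtain X f where X: "X \<subseteq> U" and f: "isometry_onto N e X d f"
    using universal[of N e] by blast
  have f_in: "f i \<in> U" if "i \<in> N" for i
    using f X that by (auto simp: isometry_onto_def)
  have f_d: "d (f i) (f j) = e i j" if "i \<in> N" "j \<in> N" for i j
    using f that by (auto simp: isometry_onto_def)
  have fc: "d (f (c a)) (f (c b)) = d a b" if "a \<in> F" "b \<in> F" for a b
    using that by (simp add: f_d c_in e_simps)
  define ret where "ret = inv_into F (\<lambda>a. f (c a))"
  have inj: "inj_on (\<lambda>a. f (c a)) F"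
  proof (rule inj_onI)
    fix a b assume ab: "a \<in> F" "b \<in> F" "f (c a) = f (c b)"
    then have "d a b = 0" using fc[of a b] f_in[OF c_in, of b] by simp
    then show "a = b" using ab in_U by simp
  qed
  have ret: "ret (f (c a)) = a" if "a \<in> F" for a
    unfolding ret_def by (rule inv_into_f_f[OF inj that])
  let ?X = "(\<lambda>a. f (c a)) ` F"
  have "isometry_onto ?X d F d ret"
    unfolding isometry_onto_def by (auto simp: ret fc image_image)
  moreover have "finite ?X" "?X \<subseteq> U" using F f_in c_in by auto
  ultimately obtain g where g: "isometry_onto U d U d g" "\<forall>x\<in>?X. g x = ret x"
    using homogeneous[of ?X F ret] F by blast
  have z: "g (f 0) \<in> U" using g(1) f_in[of 0] by (auto simp: isometry_onto_def N_def)
  have "d (g (f 0)) a = \<phi> a" if a: "a \<in> F" for a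
  proof -
    have "d (g (f 0)) a = d (g (f 0)) (g (f (c a)))" using g(2) a ret by auto
    also have "\<dots> = d (f 0) (f (c a))"
      using g(1) f_in[of 0] f_in[OF c_in[OF a]] by (simp add: isometry_onto_def N_def)
    also have "\<dots> = \<phi> a" using a by (simp add: f_d c_in e_simps N_def)
    finally show ?thesis .
  qed
  with z show ?thesis by blast
qed

text \<open>
  The form of hyperconvexity behind all later constructions: finitely many balls whose radii permit
  them to meet do have a common point \<open>z\<close>, even one that is as far as possible from a given finite set,
  every distance being that of the shortest way through one of the centers. The lower bound makes \<open>z\<close> a
  free amalgam; the upper bound, taken at the centers, puts it into the balls.
\<close>

lemma common_point_of_balls:
  assumes A: "finite A" "A \<noteq> {}" "fst ` A \<subseteq> U" "snd ` A \<subseteq> \<rat>"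
    and F: "finite F" "F \<subseteq> U"
    and meet: "\<And>c r c' r'. (c, r) \<in> A \<Longrightarrow> (c', r') \<in> A \<Longrightarrow> d c c' \<le> r + r'"
  shows "\<exists>z\<in>U. \<forall>w\<in>F. d z w = (MIN (c, r)\<in>A. r + d c w)"
proof -
  define \<phi> where "\<phi> w = (MIN (c, r)\<in>A. r + d c w)" for w
  have le: "\<phi> w \<le> r + d c w" if "(c, r) \<in> A" for c r w
    unfolding \<phi>_def using A that by (intro Min_le) (auto intro: rev_image_eqI)
  have attained: "\<exists>c r. (c, r) \<in> A \<and> c \<in> U \<and> r \<in> \<rat> \<and> \<phi> w = r + d c w" for w
  proof -
    have "\<phi> w \<in> (\<lambda>(c, r). r + d c w) ` A"
      unfolding \<phi>_def using A by (intro Min_in) auto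
    then show ?thesis using A by force
  qed
  have lip: "\<phi> a \<le> \<phi> b + d a b" if "a \<in> U" "b \<in> U" for a b
  proof -
    obtain c r where c: "(c, r) \<in> A" "c \<in> U" "\<phi> b = r + d c b" using attained[of b] by blast
    have "\<phi> a \<le> r + d c a" using le[OF c(1)] .
    also have "\<dots> \<le> r + (d c b + d a b)" using triangle[of c b a] that c commute[of a b] by simp
    finally show ?thesis using c by simp
  qed
  have wide: "d a b \<le> \<phi> a + \<phi> b" if "a \<in> U" "b \<in> U" for a b
  proof -
    obtain c r where c: "(c, r) \<in> A" "c \<in> U" "\<phi> a = r + d c a" using attained[of a] by blast
    obtain c' r' where c': "(c', r') \<in> A" "c' \<in> U" "\<phi> b = r' + d c' b" using attained[of b] by blast
    have "d a b \<le> d c a + d c c' + d c' b"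
      using triangle[of a c b] triangle[of c c' b] that c c' commute[of a c] by simp
    then show ?thesis using meet[OF c(1) c'(1)] c c' by simp
  qed
  show ?thesis
  proof (cases "\<exists>a\<in>F. \<phi> a = 0")
    case True
    \<comment> \<open>The required point already lies in \<open>F\<close>.\<close>
    then obtain a where a: "a \<in> F" "a \<in> U" "\<phi> a = 0" using F by blast
    have "d a w = \<phi> w" if "w \<in> F" for w
      using lip[of w a] wide[of a w] a that F commute[of a w] by force
    then show ?thesis using a unfolding \<phi>_def by blast
  next
    case False
    have "\<exists>z\<in>U. \<forall>a\<in>F. d z a = \<phi> a"
    proof (rule realize_Katetov_function[OF F])
      show "\<phi> a \<in> \<rat>" if "a \<in> F" for a
        using attained[of a] that F rational_distances by (metis Rats_add subsetD)
      show "\<phi> a > 0" if "a \<in> F" for a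
        using wide[of a a] False that F nonneg[of a a] by (cases "\<phi> a" "0::real" rule: linorder_cases) auto
      show "\<phi> a \<le> \<phi> b + d a b" if "a \<in> F" "b \<in> F" for a b using that lip F by blast
      show "d a b \<le> \<phi> a + \<phi> b" if "a \<in> F" "b \<in> F" for a b using that wide F by blast
    qed
    then show ?thesis unfolding \<phi>_def .
  qed
qed

lemma carrier_nonempty: "U \<noteq> {}"
proof -
  have "Metric_space {0::nat} (\<lambda>_ _. 0)" by (simp add: Metric_space_def)
  then obtain X f where "X \<subseteq> U" "isometry_onto {0::nat} (\<lambda>_ _. 0) X d f"
    using universal[of "{0}" "\<lambda>_ _. 0"] by auto
  then show ?thesis by (auto simp: isometry_onto_def)
qed

section \<open>Sequences over which nonexpansive maps extend\<close>

text \<open>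
  The extension is found along the enumeration \<open>u\<close> of \<open>U\<close>. The image of \<open>u i\<close> has to lie in infinitely
  many balls, around the images of the earlier points and around all \<open>q n\<close>. By the support
  condition, the distance from \<open>u i\<close> to \<open>p n\<close> is realized through some \<open>p j\<close> with \<open>j \<le> i\<close>, so
  the balls around \<open>q j\<close> for \<open>j \<le> i\<close> take care of the others.
\<close>

lemma extend_finitely_supported:
  fixes u p q :: "nat \<Rightarrow> 'a"
  assumes u: "range u = U" and p: "range p \<subseteq> U" and q: "range q \<subseteq> U"
    and support: "\<And>i n. \<exists>j\<le>i. d (p n) (p j) + d (p j) (u i) \<le> d (p n) (u i)"
    and pq: "\<And>i j. d (q i) (q j) \<le> d (p i) (p j)"
  shows "\<exists>k\<in>nonexpansive_maps U d. \<forall>i. k (p i) = q i"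
proof -
  have uU: "u i \<in> U" and pU: "p i \<in> U" and qU: "q i \<in> U" for i :: nat
    using u p q by auto
  define P where "P y i r \<longleftrightarrow> r \<in> U \<and> (\<forall>l<i. d r (y l) \<le> d (u i) (u l)) \<and>
    (\<forall>j. d r (q j) \<le> d (u i) (p j))" for y :: "nat \<Rightarrow> 'a" and i :: nat and r
  have "\<exists>y. \<forall>i. P y i (y i)"
  proof (rule dependent_wellorder_choice)
    show "P f i r = P g i r" if "\<And>l. l < i \<Longrightarrow> f l = g l" for r f g i
      using that by (simp add: P_def)
    fix i y assume IH: "\<And>l. l < i \<Longrightarrow> P y l (y l)"
    define A where "A = (\<lambda>l. (y l, d (u i) (u l))) ` {..<i} \<union> (\<lambda>j. (q j, d (u i) (p j))) ` {..i}"
    have yU: "y l \<in> U" if "l < i" for l using IH that by (simp add: P_def)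
    have yy: "d (y l) (y l') \<le> d (u i) (u l) + d (u i) (u l')" if "l < i" "l' < i" for l l'
    proof -
      have "d (y l) (y l') \<le> d (u l) (u l')"
        using IH[OF that(1)] IH[OF that(2)] yU that
        by (cases l l' rule: linorder_cases) (auto simp: P_def commute)
      then show ?thesis using triangle[of "u l" "u i" "u l'"] uU commute[of "u l"] by simp
    qed
    have qq: "d (q j) (q j') \<le> d (u i) (p j) + d (u i) (p j')" for j j'
      using pq[of j j'] triangle[of "p j" "u i" "p j'"] uU pU commute[of "p j"] by simp
    have yq: "d (y l) (q j) \<le> d (u i) (u l) + d (u i) (p j)" if "l < i" for l j
    proof -
      have "d (y l) (q j) \<le> d (u l) (p j)" using IH[OF that] by (simp add: P_def)
      then show ?thesis using triangle[of "u l" "u i" "p j"] uU pU commute[of "u l"] by simp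
    qed
    have qy: "d (q j) (y l) \<le> d (u i) (p j) + d (u i) (u l)" if "l < i" for l j
      using yq[OF that, of j] by (simp add: commute)
    have "\<exists>z\<in>U. \<forall>w\<in>fst ` A. d z w = (MIN (c, r)\<in>A. r + d c w)"
    proof (rule common_point_of_balls)
      show "d c c' \<le> r + r'" if "(c, r) \<in> A" "(c', r') \<in> A" for c r c' r'
        using that by (auto simp: A_def yy qq yq qy)
    qed (auto simp: A_def yU qU uU pU rational_distances)
    then obtain z where z: "z \<in> U" "\<And>w. w \<in> fst ` A \<Longrightarrow> d z w = (MIN (c, r)\<in>A. r + d c w)" by blast
    have ball: "d z c \<le> r" if "(c, r) \<in> A" for c r
    proof -
      have "c \<in> U" using that yU qU by (auto simp: A_def)
      moreover have "finite A" by (simp add: A_def)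
      ultimately have "(MIN (c', r')\<in>A. r' + d c' c) \<le> r"
        using that by (intro Min_le_iff[THEN iffD2]) force+
      then show ?thesis using z(2)[of c] that by force
    qed
    have "d z (q n) \<le> d (u i) (p n)" for n
    proof -
      obtain j where j: "j \<le> i" "d (p n) (p j) + d (p j) (u i) \<le> d (p n) (u i)"
        using support by blast
      have "d z (q n) \<le> d z (q j) + d (q j) (q n)" using triangle z(1) qU by blast
      also have "\<dots> \<le> d (u i) (p j) + d (p j) (p n)"
        using ball[of "q j" "d (u i) (p j)"] j(1) pq[of j n] by (simp add: A_def add_mono)
      also have "\<dots> \<le> d (u i) (p n)"
        using j(2) uU pU by (simp add: commute)
      finally show ?thesis .
    qed
    moreover have "d z (y l) \<le> d (u i) (u l)" if "l < i" for l
      using ball that by (simp add: A_def)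
    ultimately show "\<exists>r. P y i r" using z(1) by (auto simp: P_def)
  qed
  then obtain y where y: "\<And>i. P y i (y i)" by blast
  have yU: "y i \<in> U" for i using y by (simp add: P_def)
  have yy: "d (y i) (y j) \<le> d (u i) (u j)" for i j
    using y[of i] y[of j] yU uU by (cases i j rule: linorder_cases) (auto simp: P_def commute)
  define k where "k = (\<lambda>x\<in>U. y (inv_into UNIV u x))"
  have u_inv: "u (inv_into UNIV u x) = x" if "x \<in> U" for x
    using that u by (metis f_inv_into_f)
  have "k \<in> nonexpansive_maps U d"
    unfolding nonexpansive_maps_def k_def using yU by (auto simp: u_inv intro: order.trans[OF yy])
  \<comment> \<open>\<open>p n\<close> is itself some \<open>u i\<close>, whose image lies in the ball of radius \<open>0\<close> around \<open>q n\<close>.\<close>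
  moreover have "k (p n) = q n" for n
  proof -
    have "d (k (p n)) (q n) \<le> d (u (inv_into UNIV u (p n))) (p n)"
      using y pU by (simp add: k_def P_def)
    then have "d (k (p n)) (q n) \<le> 0" using pU by (simp add: u_inv)
    then have "d (k (p n)) (q n) = 0" by (rule antisym[OF _ nonneg])
    moreover have "k (p n) \<in> U" using pU yU by (simp add: k_def)
    ultimately show ?thesis using qU by simp
  qed
  ultimately show ?thesis by blast
qed

text \<open>
  The point \<open>p n\<close> is chosen as the free amalgam, over \<open>p 0, \<dots>, p (n - 1)\<close>, of the new point
  with \<open>u 0, \<dots>, u (n - 1)\<close>. Thus once \<open>u i\<close> has appeared, all later \<open>p n\<close> are linked to it
  through \<open>p 0, \<dots>, p i\<close> only, which is the support condition of the preceding lemma. Working with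
  a pseudometric on indices allows the sequence to repeat points.
\<close>

lemma embed_with_extensions:
  fixes \<delta> :: "nat \<Rightarrow> nat \<Rightarrow> real"
  assumes rat: "\<And>i j. \<delta> i j \<in> \<rat>" and refl: "\<And>i. \<delta> i i = 0" and sym: "\<And>i j. \<delta> i j = \<delta> j i"
    and tri: "\<And>i j k. \<delta> i k \<le> \<delta> i j + \<delta> j k"
  obtains p where "range p \<subseteq> U" "\<And>i j. d (p i) (p j) = \<delta> i j"
    "\<And>q. range q \<subseteq> U \<Longrightarrow> (\<And>i j. d (q i) (q j) \<le> \<delta> i j) \<Longrightarrow>
       \<exists>k\<in>nonexpansive_maps U d. \<forall>i. k (p i) = q i"
proof -
  define u where "u = from_nat_into U"
  have u: "range u = U"
    unfolding u_def by (rule range_from_nat_into[OF carrier_nonempty countable_carrier])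
  then have uU: "u i \<in> U" for i by auto
  define P where "P f n r \<longleftrightarrow> r \<in> U \<and> (\<forall>l<n. d r (f l) = \<delta> n l) \<and>
    (\<forall>i<n. \<exists>j<n. d r (u i) = \<delta> n j + d (f j) (u i))" for f :: "nat \<Rightarrow> 'a" and n :: nat and r
  have "\<exists>f. \<forall>n. P f n (f n)"
  proof (rule dependent_wellorder_choice)
    show "P f i r = P g i r" if "\<And>l. l < i \<Longrightarrow> f l = g l" for r f g i
      using that by (simp add: P_def cong: conj_cong)
    fix n p assume IH: "\<And>l. l < n \<Longrightarrow> P p l (p l)"
    show "\<exists>r. P p n r"
    proof (cases "n = 0")
      case True
      then show ?thesis using carrier_nonempty by (auto simp: P_def)
    next
      case False
      have pU: "p l \<in> U" if "l < n" for l using IH that by (simp add: P_def)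
      have pp: "d (p l) (p l') = \<delta> l l'" if "l < n" "l' < n" for l l'
        using IH[OF that(1)] IH[OF that(2)] pU that refl
        by (cases l l' rule: linorder_cases) (auto simp: P_def commute sym)
      define A where "A = (\<lambda>j. (p j, \<delta> n j)) ` {..<n}"
      have "\<exists>z\<in>U. \<forall>w\<in>p ` {..<n} \<union> u ` {..<n}. d z w = (MIN (c, r)\<in>A. r + d c w)"
      proof (rule common_point_of_balls)
        show "d c c' \<le> r + r'" if "(c, r) \<in> A" "(c', r') \<in> A" for c r c' r'
          using that tri[of _ _ n] by (auto simp: A_def pp sym[of n])
      qed (use False in \<open>auto simp: A_def pU uU rat\<close>)
      then obtain z where z: "z \<in> U"
        and z_eq: "\<And>w. w \<in> p ` {..<n} \<union> u ` {..<n} \<Longrightarrow> d z w = (MIN (c, r)\<in>A. r + d c w)"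
        by blast
      have attained: "\<exists>j<n. d z w = \<delta> n j + d (p j) w" if "w \<in> p ` {..<n} \<union> u ` {..<n}" for w
      proof -
        have "d z w \<in> (\<lambda>(c, r). r + d c w) ` A"
          unfolding z_eq[OF that] using False by (intro Min_in) (auto simp: A_def)
        then show ?thesis by (auto simp: A_def)
      qed
      have "d z (p l) = \<delta> n l" if l: "l < n" for l
      proof (rule antisym)
        have "(MIN (c, r)\<in>A. r + d c (p l)) \<le> \<delta> n l + d (p l) (p l)"
          using l by (intro Min_le) (auto simp: A_def)
        then show "d z (p l) \<le> \<delta> n l" using z_eq[of "p l"] l pU by simp
        obtain j where "j < n" "d z (p l) = \<delta> n j + d (p j) (p l)" using attained[of "p l"] l by auto
        then show "\<delta> n l \<le> d z (p l)" using tri[of n l j] pp l by simp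
      qed
      then show ?thesis using z attained by (auto simp: P_def)
    qed
  qed
  then obtain p where P: "\<And>n. P p n (p n)" by blast
  have pU: "p n \<in> U" for n using P by (simp add: P_def)
  have pp: "d (p i) (p j) = \<delta> i j" for i j
    using P[of i] P[of j] pU refl by (cases i j rule: linorder_cases) (auto simp: P_def commute sym)
  have support: "\<exists>j\<le>i. d (p n) (p j) + d (p j) (u i) \<le> d (p n) (u i)" for i n
  proof (induction n rule: less_induct)
    case (less n)
    show ?case
    proof (cases "n \<le> i")
      case True
      then show ?thesis using refl pp by auto
    next
      case False
      then obtain j where j: "j < n" "d (p n) (u i) = \<delta> n j + d (p j) (u i)"
        using P[of n] unfolding P_def by (meson not_le)
      obtain l where "l \<le> i" "d (p j) (p l) + d (p l) (u i) \<le> d (p j) (u i)"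
        using less[OF j(1)] by blast
      then show ?thesis using j tri[of n l j] pp by (intro exI[of _ l]) simp
    qed
  qed
  show thesis
  proof (rule that[of p])
    fix q assume "range q \<subseteq> U" "\<And>i j. d (q i) (q j) \<le> \<delta> i j"
    then show "\<exists>k\<in>nonexpansive_maps U d. \<forall>i. k (p i) = q i"
      using pU pp by (intro extend_finitely_supported[OF u _ _ support]) auto
  qed (use pU pp in auto)
qed

section \<open>Finite supports of left congruences with countably many classes\<close>

text \<open>
  Without a finite support, every set \<open>S\<close> of naturals can be coded by a nonexpansive map \<open>m S\<close> in
  such a way that \<open>\<phi> (m S)\<close> determines \<open>S\<close>.
\<close>

lemma finite_support:
  fixes \<phi> :: "('a \<Rightarrow> 'a) \<Rightarrow> 'c"
  defines "T \<equiv> nonexpansive_maps U d"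
  assumes count: "countable (\<phi> ` T)"
    and cong: "\<And>f g k. f \<in> T \<Longrightarrow> g \<in> T \<Longrightarrow> k \<in> T \<Longrightarrow> \<phi> f = \<phi> g \<Longrightarrow>
      \<phi> (compose U k f) = \<phi> (compose U k g)"
  shows "\<exists>F. finite F \<and> F \<subseteq> U \<and> (\<forall>f\<in>T. \<forall>g\<in>T. (\<forall>x\<in>F. f x = g x) \<longrightarrow> \<phi> f = \<phi> g)"
proof (rule ccontr)
  assume no: "\<not> ?thesis"
  define u where "u = from_nat_into U"
  have uU: "u i \<in> U" for i unfolding u_def by (rule from_nat_into[OF carrier_nonempty])
  define ix where "ix = to_nat_on U"
  have u_ix: "u (ix x) = x" if "x \<in> U" for x
    unfolding u_def ix_def using countable_carrier that by simp
  have "\<exists>f g. f \<in> T \<and> g \<in> T \<and> (\<forall>i<n. f (u i) = g (u i)) \<and> \<phi> f \<noteq> \<phi> g" for n :: nat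
  proof -
    have "finite (u ` {..<n})" "u ` {..<n} \<subseteq> U" using uU by auto
    with no have "\<not> (\<forall>f\<in>T. \<forall>g\<in>T. (\<forall>x\<in>u ` {..<n}. f x = g x) \<longrightarrow> \<phi> f = \<phi> g)" by blast
    then show ?thesis by auto
  qed
  then obtain f g where f: "\<And>n. f n \<in> T" and g: "\<And>n. g n \<in> T"
    and agree: "\<And>n i. i < n \<Longrightarrow> f n (u i) = g n (u i)" and differ: "\<And>n. \<phi> (f n) \<noteq> \<phi> (g n)"
    by metis
  have T_in: "k x \<in> U" if "k \<in> T" "x \<in> U" for k x
    using that by (auto simp: T_def nonexpansive_maps_def)
  have T_le: "d (k x) (k y) \<le> d x y" if "k \<in> T" "x \<in> U" "y \<in> U" for k x y
    using that by (auto simp: T_def nonexpansive_maps_def)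

  \<comment> \<open>An index \<open>e\<close> codes a number \<open>lev e\<close>, naming the point \<open>pt e\<close> of \<open>U\<close>, and a finite set of naturals,
    which selects for each \<open>n\<close> the coordinate \<open>co e n\<close>. For \<open>n > lev e\<close> the choice
    between \<open>f n\<close> and \<open>g n\<close> is immaterial.\<close>
  define pt where "pt e = u (fst (prod_decode e))" for e
  define co where "co e n = (if n \<in> set_decode (snd (prod_decode e)) then f n (pt e) else g n (pt e))" for e n
  define lev where "lev e = fst (prod_decode e)" for e
  have ptU: "pt e \<in> U" for e by (simp add: pt_def uU)
  have coU: "co e n \<in> U" for e n by (simp add: co_def T_in f g ptU)
  have tail: "d (co e n) (co e' n) \<le> d (pt e) (pt e')" if "n > max (lev e) (lev e')" for e e' n
    using that agree[of "lev e" n] agree[of "lev e'" n] T_le[OF g ptU ptU]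
    by (auto simp: co_def pt_def lev_def)
  \<comment> \<open>The supremum metric of the points and all coordinates. As the tail is dominated by the distance of
    the points, the supremum is a finite maximum and therefore rational.\<close>
  define \<delta> where "\<delta> e e' = Max (insert (d (pt e) (pt e')) ((\<lambda>n. d (co e n) (co e' n)) ` {..max (lev e) (lev e')}))" for e e'
  have \<delta>_le_iff: "\<delta> e e' \<le> r \<longleftrightarrow> d (pt e) (pt e') \<le> r \<and> (\<forall>n. d (co e n) (co e' n) \<le> r)" for e e' r
  proof -
    have "\<delta> e e' \<le> r \<longleftrightarrow> d (pt e) (pt e') \<le> r \<and> (\<forall>n\<le>max (lev e) (lev e'). d (co e n) (co e' n) \<le> r)"
      unfolding \<delta>_def by (subst Max_le_iff) auto
    also have "\<dots> \<longleftrightarrow> d (pt e) (pt e') \<le> r \<and> (\<forall>n. d (co e n) (co e' n) \<le> r)"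
      using tail[of e e'] by (meson leI order_trans)
    finally show ?thesis .
  qed
  have \<delta>_pt: "d (pt e) (pt e') \<le> \<delta> e e'" and \<delta>_co: "d (co e n) (co e' n) \<le> \<delta> e e'" for e e' n
    using \<delta>_le_iff[of e e' "\<delta> e e'"] by blast+
  obtain p where pU: "range p \<subseteq> U" and pp: "\<And>i j. d (p i) (p j) = \<delta> i j"
    and ext: "\<And>q. range q \<subseteq> U \<Longrightarrow> (\<And>i j. d (q i) (q j) \<le> \<delta> i j) \<Longrightarrow> \<exists>k\<in>nonexpansive_maps U d. \<forall>i. k (p i) = q i"
  proof (rule embed_with_extensions[of \<delta>])
    fix e e' e''
    have "\<delta> e e' \<in> insert (d (pt e) (pt e')) ((\<lambda>n. d (co e n) (co e' n)) ` {..max (lev e) (lev e')})"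
      unfolding \<delta>_def by (rule Max_in) auto
    then show "\<delta> e e' \<in> \<rat>" using rational_distances ptU coU by auto
    show "\<delta> e e = 0"
    proof (rule antisym)
      show "\<delta> e e \<le> 0" using ptU coU by (simp add: \<delta>_le_iff)
      show "0 \<le> \<delta> e e" by (rule order_trans[OF nonneg \<delta>_pt])
    qed
    show "\<delta> e e' = \<delta> e' e" by (simp add: \<delta>_def commute max.commute)
    show "\<delta> e e'' \<le> \<delta> e e' + \<delta> e' e''"
      unfolding \<delta>_le_iff
    proof (intro conjI allI)
      show "d (pt e) (pt e'') \<le> \<delta> e e' + \<delta> e' e''"
        by (rule order_trans[OF triangle[OF ptU ptU ptU] add_mono[OF \<delta>_pt \<delta>_pt]])
      show "d (co e n) (co e'' n) \<le> \<delta> e e' + \<delta> e' e''" for n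
        by (rule order_trans[OF triangle[OF coU coU coU] add_mono[OF \<delta>_co \<delta>_co]])
    qed
  qed blast
  have "\<exists>k\<in>T. \<forall>e. k (p e) = co e n" for n
    unfolding T_def by (rule ext) (use \<delta>_co coU in auto)
  then obtain k where k: "\<And>n. k n \<in> T" and kp: "\<And>n e. k n (p e) = co e n" by metis

  \<comment> \<open>Truncating \<open>S\<close> at the index of \<open>x\<close> loses nothing, since \<open>f n x = g n x\<close> beyond it.\<close>
  define code where "code S x = prod_encode (ix x, set_encode (S \<inter> {..ix x}))" for S x
  have pt_code: "pt (code S x) = x" if "x \<in> U" for S x
    using that by (simp add: pt_def code_def u_ix)
  have co_code: "co (code S x) n = (if n \<in> S then f n x else g n x)" if "x \<in> U" for S x n
    using agree[of "ix x" n] pt_code[OF that, of S] that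
    by (auto simp: co_def code_def u_ix not_le)
  define m where "m S = (\<lambda>x\<in>U. p (code S x))" for S
  have m: "m S \<in> T" for S
    unfolding T_def nonexpansive_maps_def
    using pU by (auto simp: m_def pp \<delta>_le_iff pt_code co_code T_le f g)
  have km: "compose U (k n) (m S) = (if n \<in> S then f n else g n)" for n S
  proof
    fix x
    show "compose U (k n) (m S) x = (if n \<in> S then f n else g n) x"
      using f[of n] g[of n]
      by (auto simp: compose_def m_def kp co_code T_def nonexpansive_maps_def PiE_def extensional_def)
  qed
  have "inj (\<lambda>S. \<phi> (m S))"
  proof (rule injI)
    fix S S' :: "nat set" assume eq: "\<phi> (m S) = \<phi> (m S')"
    have "n \<in> S \<longleftrightarrow> n \<in> S'" for n
      using cong[OF m m k[of n] eq] differ[of n] by (auto simp: km split: if_splits)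
    then show "S = S'" by blast
  qed
  moreover have "countable (range (\<lambda>S. \<phi> (m S)))"
    using m by (intro countable_subset[OF _ count]) auto
  ultimately have "countable (UNIV :: nat set set)"
    by (rule countable_image_inj_on[rotated])
  then have "range (from_nat_into (UNIV :: nat set set)) = UNIV"
    by (rule range_from_nat_into[OF UNIV_not_empty])
  then show False
    using Cantors_theorem[of "UNIV :: nat set"] by auto
qed

end

section \<open>Automatic homeomorphicity\<close>

text \<open>
  The maps that agree with \<open>f\<close> on a finite set form a basic neighbourhood of \<open>f\<close>, on which every
  evaluation supported by that set is constant.
\<close>

lemma continuous_map_pointwise_if_finite_support:
  assumes T: "T \<subseteq> A \<rightarrow>\<^sub>E A" and T': "h \<in> T \<rightarrow> T'" "T' \<subseteq> B \<rightarrow>\<^sub>E B"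
    and supp: "\<And>b. b \<in> B \<Longrightarrow> \<exists>F. finite F \<and> F \<subseteq> A \<and>
      (\<forall>f\<in>T. \<forall>g\<in>T. (\<forall>x\<in>F. f x = g x) \<longrightarrow> h f b = h g b)"
  shows "continuous_map (pointwise_topology A T) (pointwise_topology B T') h"
proof -
  have top: "topspace (pointwise_topology A T) = T"
    using T by (auto simp: pointwise_topology_def)
  have "continuous_map (pointwise_topology A T) (discrete_topology B) (\<lambda>f. h f b)" if b: "b \<in> B" for b
  proof -
    obtain F where F: "finite F" "F \<subseteq> A"
      and det: "\<And>f g. f \<in> T \<Longrightarrow> g \<in> T \<Longrightarrow> (\<And>x. x \<in> F \<Longrightarrow> f x = g x) \<Longrightarrow> h f b = h g b"
      using supp[OF b] by metis
    have "openin (pointwise_topology A T) {f \<in> T. h f b \<in> V}" for V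
    proof (subst openin_subopen, intro ballI)
      fix f assume f: "f \<in> {f \<in> T. h f b \<in> V}"
      define N where "N = T \<inter> (\<Pi>\<^sub>E x\<in>A. if x \<in> F then {f x} else A)"
      have fA: "f \<in> A \<rightarrow>\<^sub>E A" using f T by auto
      have "openin (product_topology (\<lambda>_. discrete_topology A) A) (\<Pi>\<^sub>E x\<in>A. if x \<in> F then {f x} else A)"
        using F fA by (intro product_topology_basis)
          (auto intro: finite_subset[OF _ F(1)] split: if_splits)
      then have "openin (pointwise_topology A T) N"
        unfolding pointwise_topology_def N_def openin_subtopology by (metis inf_commute)
      moreover have "f \<in> N" using f fA by (auto simp: N_def PiE_iff)
      moreover have "N \<subseteq> {f \<in> T. h f b \<in> V}"
      proof
        fix g assume g: "g \<in> N"
        then have "h g b = h f b"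
        proof (intro det)
          show "g x = f x" if "x \<in> F" for x
            using g that F(2) by (auto simp: N_def PiE_iff dest: bspec[of A _ x])
        qed (use f in \<open>auto simp: N_def\<close>)
        then show "g \<in> {f \<in> T. h f b \<in> V}" using f g by (auto simp: N_def)
      qed
      ultimately show "\<exists>N. openin (pointwise_topology A T) N \<and> f \<in> N \<and> N \<subseteq> {f \<in> T. h f b \<in> V}"
        by blast
    qed
    then show ?thesis
      using T' b by (auto simp: continuous_map_def top)
  qed
  then show ?thesis
    unfolding pointwise_topology_def[of B]
    using T' top by (auto simp: continuous_map_in_subtopology continuous_map_componentwise PiE_def)
qed

text \<open>
  The kernel of \<open>z\<close> is an equivalence relation that contains the weak preorder, so \<open>z\<close> is constant on
  weak orbits.
\<close>

lemma finite_image_of_left_zero: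
  assumes orbits: "finite (weak_orbits B T)"
    and z: "\<And>m b. m \<in> T \<Longrightarrow> b \<in> B \<Longrightarrow> z (m b) = z b"
  shows "finite (z ` B)"
proof -
  let ?r = "{(a, b). a \<in> B \<and> b \<in> B \<and> z a = z b}"
  define E where "E = \<Inter>{r. equiv B r \<and> weak_preorder B T \<subseteq> r}"
  have "equiv B ?r"
    by (auto simp: equiv_def refl_on_def sym_def trans_def)
  moreover have "weak_preorder B T \<subseteq> ?r" using z by (auto simp: weak_preorder_def)
  ultimately have E_le: "E \<subseteq> ?r" unfolding E_def by (intro Inter_lower) simp
  have E_refl: "(b, b) \<in> E" if "b \<in> B" for b
    using that by (auto simp: E_def equiv_def refl_on_def)
  have "z b \<in> (\<lambda>X. z (SOME x. x \<in> X)) ` weak_orbits B T" if b: "b \<in> B" for b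
  proof (rule rev_image_eqI)
    show "E `` {b} \<in> weak_orbits B T"
      unfolding weak_orbits_def E_def[symmetric] using b by (rule quotientI)
    have "(SOME x. x \<in> E `` {b}) \<in> E `` {b}"
      by (rule someI[of _ b]) (simp add: E_refl b)
    then show "z b = z (SOME x. x \<in> E `` {b})" using E_le by blast
  qed
  then have "z ` B \<subseteq> (\<lambda>X. z (SOME x. x \<in> X)) ` weak_orbits B T" by blast
  then show ?thesis using orbits by (rule finite_subset[OF _ finite_imageI])
qed

theorem theorem4p13:
  fixes U :: "'a set" and d :: "'a \<Rightarrow> 'a \<Rightarrow> real"
    and B :: "'b set" and I :: "'i set" and ar :: "'i \<Rightarrow> nat" and R :: "'i \<Rightarrow> 'b list set"
    and h :: "('a \<Rightarrow> 'a) \<Rightarrow> ('b \<Rightarrow> 'b)"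
  assumes "rational_Urysohn_space U d"
    and "relational_structure B I ar R"
    and "countable B"
    and "finite (weak_orbits B (endomorphisms B I R))"
    and "h \<in> iso (transformation_monoid U (nonexpansive_maps U d))
                  (transformation_monoid B (endomorphisms B I R))"
  shows "homeomorphic_map (pointwise_topology U (nonexpansive_maps U d))
                          (pointwise_topology B (endomorphisms B I R)) h"
proof -
  interpret rational_Urysohn_space U d by fact
  define T where "T = nonexpansive_maps U d"
  define T' where "T' = endomorphisms B I R"
  have TE: "T \<subseteq> U \<rightarrow>\<^sub>E U" by (auto simp: T_def nonexpansive_maps_def)
  have T'E: "T' \<subseteq> B \<rightarrow>\<^sub>E B" by (auto simp: T'_def endomorphisms_def)
  have bij: "bij_betw h T T'"
    and mult: "\<And>f g. f \<in> T \<Longrightarrow> g \<in> T \<Longrightarrow> h (compose U f g) = compose B (h f) (h g)"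
    using assms(5) by (auto simp: iso_def hom_def transformation_monoid_def T_def T'_def)
  have hT: "h f \<in> T'" if "f \<in> T" for f using bij that by (auto simp: bij_betw_def)
  have inv: "inv_into T h m \<in> T" "h (inv_into T h m) = m" if "m \<in> T'" for m
    using bij that by (auto simp: bij_betw_def inv_into_into f_inv_into_f)
  have forward: "continuous_map (pointwise_topology U T) (pointwise_topology B T') h"
  proof (rule continuous_map_pointwise_if_finite_support[OF TE _ T'E])
    show "h \<in> T \<rightarrow> T'" using hT by blast
    fix b assume b: "b \<in> B"
    have "h f b \<in> B" if "f \<in> T" for f using hT[OF that] T'E b by auto
    then have "countable ((\<lambda>f. h f b) ` T)"
      using assms(3) by (meson countable_subset image_subsetI)
    moreover have "h (compose U k f) b = h (compose U k g) b"
      if "f \<in> T" "g \<in> T" "k \<in> T" "h f b = h g b" for f g k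
      using that b by (simp add: mult compose_eq)
    ultimately show "\<exists>F. finite F \<and> F \<subseteq> U \<and>
        (\<forall>f\<in>T. \<forall>g\<in>T. (\<forall>x\<in>F. f x = g x) \<longrightarrow> h f b = h g b)"
      unfolding T_def by (rule finite_support[of "\<lambda>f. h f b"])
  qed
  have backward: "continuous_map (pointwise_topology B T') (pointwise_topology U T) (inv_into T h)"
  proof (rule continuous_map_pointwise_if_finite_support[OF T'E _ TE])
    show "inv_into T h \<in> T' \<rightarrow> T" using inv by blast
    fix x assume x: "x \<in> U"
    \<comment> \<open>The left zeros of the monoid; it acts on them as it acts on \<open>U\<close>.\<close>
    define c where "c y = (\<lambda>_\<in>U. y)" for y :: 'a
    have c: "c y \<in> T" if "y \<in> U" for y
      using that by (auto simp: c_def T_def nonexpansive_maps_def)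
    have c_comp: "compose U (c x) f = c x" if "f \<in> T" for f
      using that TE by (auto simp: c_def compose_def fun_eq_iff PiE_iff)
    have comp_c: "compose U f (c x) = c (f x)" for f
      using x by (auto simp: c_def compose_def)
    let ?z = "h (c x)"
    have "?z (m b) = ?z b" if "m \<in> T'" "b \<in> B" for m b
    proof -
      have "compose B ?z m = ?z"
        using mult[OF c[OF x] inv(1)[OF that(1)]] by (simp add: c_comp inv that)
      then show ?thesis using compose_eq[OF that(2), of ?z m] by simp
    qed
    then have fin: "finite (?z ` B)"
      by (intro finite_image_of_left_zero[OF assms(4)]) (simp add: T'_def)
    have zB: "?z ` B \<subseteq> B" using hT[OF c[OF x]] T'E by auto
    have det: "inv_into T h m x = inv_into T h n x"
      if m: "m \<in> T'" and n: "n \<in> T'" and eq: "\<forall>b\<in>?z ` B. m b = n b" for m n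
    proof -
      let ?f = "inv_into T h m" and ?g = "inv_into T h n"
      have "compose B m ?z = compose B n ?z" using eq by (simp add: compose_def cong: restrict_cong)
      then have "h (c (?f x)) = h (c (?g x))"
        using mult[OF inv(1)[OF m] c[OF x]] mult[OF inv(1)[OF n] c[OF x]]
        by (simp add: comp_c inv m n)
      moreover have "?f x \<in> U" "?g x \<in> U" using inv(1)[OF m] inv(1)[OF n] TE x by auto
      ultimately have "c (?f x) = c (?g x)"
        using bij c by (meson bij_betw_imp_inj_on inj_on_eq_iff)
      then have "c (?f x) x = c (?g x) x" by simp
      then show ?thesis using x by (simp add: c_def)
    qed
    show "\<exists>F. finite F \<and> F \<subseteq> B \<and> (\<forall>m\<in>T'. \<forall>n\<in>T'. (\<forall>b\<in>F. m b = n b) \<longrightarrow>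
        inv_into T h m x = inv_into T h n x)"
      using fin zB by (intro exI[of _ "?z ` B"] conjI) (use det in blast)+
  qed
  have inv_h: "inv_into T h (h f) = f" if "f \<in> T" for f
    by (rule inv_into_f_f[OF bij_betw_imp_inj_on[OF bij] that])
  have "homeomorphic_maps (pointwise_topology U T) (pointwise_topology B T') h (inv_into T h)"
    unfolding homeomorphic_maps_def
    using forward backward inv_h inv(2) by (simp add: pointwise_topology_def)
  then have "homeomorphic_map (pointwise_topology U T) (pointwise_topology B T') h"
    unfolding homeomorphic_map_maps by blast
  then show ?thesis
    unfolding T_def T'_def .
qed

end
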